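(* Let $C>1$ be an integer. For all $j\in[t]$, let $G^{(j)}$ be a $d_j$-regular graph with $1<|V(G^{(j)})|\le C$. Let $G=\square_{j=1}^t G^{(j)}$, let $n:=|V(G)|$ and let $d:=\sum_{j=1}^t d_j$. Then for any $k\in[n]$, $$i_k(G)\ge d-(C-1)\log_2 k.$$
   Context: Graphs are finite and simple; $[m]=\{1,\ldots,m\}$. The Cartesian product $\square_{j=1}^t G^{(j)}$ of graphs $G^{(1)},\ldots,G^{(t)}$ is the graph with vertex set $V(G^{(1)})\times\cdots\times V(G^{(t)})$ in which $u$ and $v$ are adjacent iff there is some $j\in[t]$ with $u_jv_j\in E(G^{(j)})$ and $u_m=v_m$ for all $m\ne j$. For $S\subseteq V(G)$, $\partial(S)$ is the set of edges of $G$ with one endpoint in $S$ and the other in $V(G)\setminus S$. For $k\in[|V(G)|]$, $i_k(G):=\min\{|\partial(S)|/k : S\subseteq V(G),\ |S|=k\}$. *)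

theory Defs
  imports Complex_Main "HOL-Library.FuncSet" "Graph_Theory.Pair_Digraph"
begin

text \<open>
  A finite simple graph is a \<^locale>\<open>pair_graph\<close>: a finite, loopfree, symmetric set of arcs
  without parallel arcs. An undirected edge \<open>{u, v}\<close> is thus stored as the two arcs \<open>(u, v)\<close> and
  \<open>(v, u)\<close>; \<open>edges\<close> recovers the undirected edges, so that each of them is counted once.
\<close>

definition edges :: "'a pair_pre_digraph \<Rightarrow> 'a set set" where
  "edges G = {{u, v} | u v. (u, v) \<in> parcs G}"

text \<open>By symmetry of the arc set, the out-degree of a vertex is its number of neighbours.\<close>

definition regular :: "'a pair_pre_digraph \<Rightarrow> nat \<Rightarrow> bool" where
  "regular G r \<longleftrightarrow> (\<forall>v \<in> pverts G. out_degree (with_proj G) v = r)"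

text \<open>
  Tuples indexed by \<open>I\<close> are extensional functions on \<open>I\<close>, so that distinct vertices
  of the product differ at some index in \<open>I\<close>.
\<close>

definition cartesian_product ::
  "'i set \<Rightarrow> ('i \<Rightarrow> 'a pair_pre_digraph) \<Rightarrow> ('i \<Rightarrow> 'a) pair_pre_digraph" where
  "cartesian_product I G =
    \<lparr> pverts = (\<Pi>\<^sub>E j\<in>I. pverts (G j)),
      parcs = {(u, v). u \<in> (\<Pi>\<^sub>E j\<in>I. pverts (G j)) \<and> v \<in> (\<Pi>\<^sub>E j\<in>I. pverts (G j)) \<and>
                (\<exists>j\<in>I. (u j, v j) \<in> parcs (G j) \<and> (\<forall>m\<in>I - {j}. u m = v m))} \<rparr>"

definition edge_boundary :: "'a pair_pre_digraph \<Rightarrow> 'a set \<Rightarrow> 'a set set" where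
  "edge_boundary G S = {e \<in> edges G. \<exists>u\<in>S. \<exists>v\<in>pverts G - S. e = {u, v}}"

text \<open>Only meaningful for a finite graph \<open>G\<close> and \<open>1 \<le> k \<le> card (pverts G)\<close>.\<close>

definition isoperimetric_number :: "nat \<Rightarrow> 'a pair_pre_digraph \<Rightarrow> real" where
  "isoperimetric_number k G =
    Min {real (card (edge_boundary G S)) / real k | S. S \<subseteq> pverts G \<and> card S = k}"

lemma pair_graph_cartesian_product:
  assumes fin: "finite I" and G: "\<And>j. j \<in> I \<Longrightarrow> pair_graph (G j)"
  shows "pair_graph (cartesian_product I G)"
proof -
  have fv: "finite (\<Pi>\<^sub>E j\<in>I. pverts (G j))"
    using fin G by (intro finite_PiE) (auto simp: pair_graph_def pair_digraph_def
      pair_fin_digraph_def pair_fin_digraph_axioms_def)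
  have sym: "(b, a) \<in> parcs (G j)" if "j \<in> I" "(a, b) \<in> parcs (G j)" for j a b
  proof -
    interpret pair_graph "G j" using G that by blast
    show ?thesis using pair_sym_arcs that by (auto simp: symmetric_def sym_def)
  qed
  have irr: "a \<noteq> b" if "j \<in> I" "(a, b) \<in> parcs (G j)" for j a b
  proof -
    interpret pair_graph "G j" using G that by blast
    show ?thesis using pair_no_loops that by fastforce
  qed
  have sub: "parcs (cartesian_product I G) \<subseteq>
      (\<Pi>\<^sub>E j\<in>I. pverts (G j)) \<times> (\<Pi>\<^sub>E j\<in>I. pverts (G j))"
    by (auto simp: cartesian_product_def)
  show ?thesis
  proof unfold_locales
    show "finite (pverts (cartesian_product I G))"
      using fv by (simp add: cartesian_product_def)
    show "finite (parcs (cartesian_product I G))"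
      using sub fv by (meson finite_SigmaI finite_subset)
    show "symmetric (with_proj (cartesian_product I G))"
      unfolding symmetric_def sym_def
      by (simp add: cartesian_product_def) (metis sym)
  next
    fix e assume e: "e \<in> parcs (cartesian_product I G)"
    show "fst e \<in> pverts (cartesian_product I G)" "snd e \<in> pverts (cartesian_product I G)"
      using e by (auto simp: cartesian_product_def)
    show "fst e \<noteq> snd e"
      using e irr by (fastforce simp: cartesian_product_def)
  qed
qed

lemma
  assumes "finite (pverts G)" and "k \<le> card (pverts G)"
  shows isoperimetric_number_le:
      "\<lbrakk>S \<subseteq> pverts G; card S = k\<rbrakk> \<Longrightarrow>
        isoperimetric_number k G \<le> real (card (edge_boundary G S)) / real k"
    and isoperimetric_number_attained:
      "\<exists>S \<subseteq> pverts G. card S = k \<and>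
        isoperimetric_number k G = real (card (edge_boundary G S)) / real k"
proof -
  let ?A = "{real (card (edge_boundary G S)) / real k | S. S \<subseteq> pverts G \<and> card S = k}"
  have fin: "finite ?A"
    using assms(1) by simp
  obtain T where "T \<subseteq> pverts G" "card T = k"
    using obtain_subset_with_card_n[OF assms(2)] by metis
  then have "?A \<noteq> {}"
    by blast
  then have "Min ?A \<in> ?A"
    using fin by (rule Min_in[rotated])
  then show "\<exists>S \<subseteq> pverts G. card S = k \<and>
      isoperimetric_number k G = real (card (edge_boundary G S)) / real k"
    unfolding isoperimetric_number_def by blast
  show "isoperimetric_number k G \<le> real (card (edge_boundary G S)) / real k"
    if "S \<subseteq> pverts G" "card S = k"
    unfolding isoperimetric_number_def using that fin by (intro Min_le) blast+
qed

end

theory Submission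
  imports Defs
begin

text \<open>
  A vertex set \<open>S\<close> of size \<open>k\<close> in a \<open>d\<close>-regular graph has \<open>d * k\<close> outgoing arcs, counted from the
  vertices of \<open>S\<close>, and those that do not stay inside \<open>S\<close> are the boundary edges. So it suffices to
  bound the number of arcs inside \<open>S\<close> by \<open>(C - 1) * k * log 2 k\<close>. Every factor may be replaced by
  the complete graph on its vertices; then arcs are ordered pairs of tuples that differ in exactly
  one coordinate, and one inducts on the set of coordinates. Splitting \<open>S\<close> by the value of a new
  coordinate into fibres of sizes \<open>s\<^sub>x\<close>, the arcs in the new direction number at most
  \<open>\<Sum>\<^bsub>x \<noteq> y\<^esub> min s\<^sub>x s\<^sub>y\<close>. With \<open>f s = s * log 2 s\<close>, this is absorbed by
  \<open>(C - 1) * (f (\<Sum> s\<^sub>x) - \<Sum> f s\<^sub>x)\<close>: add the fibres in decreasing order of size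
  and use \<open>f (a + b) \<ge> f a + f b + 2 * b\<close> for \<open>b \<le> a\<close>.
\<close>

section \<open>Inequalities for x * log 2 x\<close>

text \<open>For fixed \<open>b > 0\<close> the gap, up to the constant \<open>2 * b\<close>, is
  \<open>?h\<close>. Its derivative \<open>log 2 (x + b) - log 2 x\<close> is nonnegative, so the
  extreme case is \<open>a = b\<close>, where doubling the argument raises the logarithm by 1 and
  equality holds.\<close>

lemma mult_log2_add_ge:
  fixes a b :: real
  assumes "0 \<le> b" "b \<le> a"
  shows "a * log 2 a + b * log 2 b + 2 * b \<le> (a + b) * log 2 (a + b)"
proof (cases "b = 0")
  case False
  with assms have b: "0 < b"
    by simp
  let ?h = "\<lambda>x. (x + b) * log 2 (x + b) - x * log 2 x - b * log 2 b"
  have "?h b \<le> ?h a"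
  proof (rule DERIV_nonneg_imp_nondecreasing[OF assms(2)])
    fix x assume "b \<le> x" "x \<le> a"
    with b have x: "0 < x"
      by simp
    have "(?h has_real_derivative log 2 (x + b) - log 2 x) (at x)"
      using x b by (auto intro!: derivative_eq_intros simp: divide_simps) (simp add: algebra_simps)
    moreover have "0 \<le> log 2 (x + b) - log 2 x"
      using x b by simp
    ultimately show "\<exists>y. (?h has_real_derivative y) (at x) \<and> 0 \<le> y"
      by blast
  qed
  moreover have "?h b = 2 * b"
    using b log_mult[of 2 2 b] by (simp add: algebra_simps flip: mult_2)
  ultimately show ?thesis
    by simp
qed simp

text \<open>Ranking by \<open>- s\<close> inserts the values in decreasing order. Each new value is
  thus the minimum in every pair it forms, and is at most the sum so far.\<close>

lemma sum_min_le_mult_log2: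
  fixes s :: "'x \<Rightarrow> real"
  assumes "finite X" "card X \<le> c" "1 \<le> c" "\<And>x. x \<in> X \<Longrightarrow> 0 \<le> s x"
  shows "(\<Sum>x\<in>X. \<Sum>y\<in>X - {x}. min (s x) (s y)) + (real c - 1) * (\<Sum>x\<in>X. s x * log 2 (s x))
           \<le> (real c - 1) * ((\<Sum>x\<in>X. s x) * log 2 (\<Sum>x\<in>X. s x))"
  using assms
proof (induction X rule: finite_ranking_induct[where f = "\<lambda>x. - s x"])
  case empty
  then show ?case by simp
next
  case (insert z X)
  \<comment> \<open>The ranking induction allows \<open>z\<close> in \<open>X\<close>, where nothing
    changes. For \<open>X = {}\<close> there are no pairs, and \<open>s z\<close> need not be
    bounded by the empty sum.\<close>
  show ?case
  proof (cases "X = {} \<or> z \<in> X")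
    case True
    with insert show ?thesis by (auto simp: insert_absorb)
  next
    case False
    then have z: "z \<notin> X" and ne: "X \<noteq> {}"
      by auto
    let ?f = "\<lambda>x::real. x * log 2 x"
    let ?A = "\<Sum>x\<in>X. s x"
    have le: "s z \<le> s x" if "x \<in> X" for x
      using insert.hyps(2)[OF that] by simp
    have sz: "0 \<le> s z"
      using insert.prems by simp
    obtain w where w: "w \<in> X"
      using ne by blast
    have "s w \<le> ?A"
      using w insert by (intro member_le_sum) auto
    with le[OF w] have A: "s z \<le> ?A"
      by linarith
    \<comment> \<open>Source of the factor \<open>c - 1\<close>: the new value forms pairs with at
      most that many earlier ones.\<close>
    have card: "real (card X) \<le> real c - 1"
      using insert z by simp
    have row: "(\<Sum>y\<in>insert z X - {x}. min (s x) (s y)) = s z + (\<Sum>y\<in>X - {x}. min (s x) (s y))"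
      if "x \<in> X" for x
    proof -
      have "insert z X - {x} = insert z (X - {x})"
        using z that by auto
      then show ?thesis
        using z insert.hyps(1) le[OF that] by (simp add: min_absorb2)
    qed
    have zrow: "(\<Sum>y\<in>insert z X - {z}. min (s z) (s y)) = real (card X) * s z"
      using z le by (simp add: min_absorb1)
    have "(\<Sum>x\<in>insert z X. \<Sum>y\<in>insert z X - {x}. min (s x) (s y))
        = 2 * (real (card X) * s z) + (\<Sum>x\<in>X. \<Sum>y\<in>X - {x}. min (s x) (s y))"
      using z insert.hyps(1) row zrow by (simp add: sum.distrib)
    moreover have "real (card X) * s z \<le> (real c - 1) * s z"
      using card sz by (rule mult_right_mono)
    moreover have "(\<Sum>x\<in>X. \<Sum>y\<in>X - {x}. min (s x) (s y)) + (real c - 1) * (\<Sum>x\<in>X. ?f (s x))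
        \<le> (real c - 1) * ?f ?A"
      using insert z by simp
    \<comment> \<open>The gain \<open>2 * s z\<close> pays for both orders of each pair through
      \<open>z\<close>.\<close>
    moreover have "(real c - 1) * (?f ?A + ?f (s z) + 2 * s z) \<le> (real c - 1) * ?f (?A + s z)"
      using mult_log2_add_ge[OF sz A] insert.prems by (intro mult_left_mono) auto
    ultimately show ?thesis
      using z insert.hyps(1) by (simp add: algebra_simps)
  qed
qed

section \<open>Arcs inside a set in a product of complete graphs\<close>

text \<open>Only the direction \<open>j\<close> is confined to \<open>I\<close>; agreement is
  required at all other indices. Hence, once a coordinate is removed from \<open>I\<close>, the
  remaining arcs stay within its fibres.\<close>

definition hamming_arcs :: "'i set \<Rightarrow> ('i \<Rightarrow> 'a) set \<Rightarrow> (('i \<Rightarrow> 'a) \<times> ('i \<Rightarrow> 'a)) set" where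
  "hamming_arcs I S = {(u, v) \<in> S \<times> S. \<exists>j\<in>I. u j \<noteq> v j \<and> (\<forall>m. m \<noteq> j \<longrightarrow> u m = v m)}"

lemma finite_hamming_arcs: "finite S \<Longrightarrow> finite (hamming_arcs I S)"
  by (rule finite_subset[of _ "S \<times> S"]) (auto simp: hamming_arcs_def)

text \<open>An arc in direction \<open>i\<close> between two given fibres is determined by either
  endpoint, since overwriting coordinate \<open>i\<close> yields the other one. So neither fibre
  size can be exceeded.\<close>

lemma card_hamming_arcs_direction_le:
  assumes "finite S"
  shows "real (card (hamming_arcs {i} S))
    \<le> (\<Sum>x\<in>(\<lambda>u. u i) ` S. \<Sum>y\<in>(\<lambda>u. u i) ` S - {x}.
         min (real (card {u\<in>S. u i = x})) (real (card {u\<in>S. u i = y})))"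
proof -
  let ?X = "(\<lambda>u. u i) ` S"
  let ?F = "\<lambda>x. {u\<in>S. u i = x}"
  let ?P = "\<lambda>x y. {(u, v) \<in> hamming_arcs {i} S. u i = x \<and> v i = y}"
  have P: "card (?P x y) \<le> min (card (?F x)) (card (?F y))" for x y
  proof (rule min.boundedI)
    have "v = u(i := y)" if "(u, v) \<in> ?P x y" for u v
      using that by (auto simp: hamming_arcs_def fun_eq_iff)
    then have "inj_on fst (?P x y)"
      by (intro inj_on_inverseI[where g = "\<lambda>u. (u, u(i := y))"]) auto
    moreover have "fst ` ?P x y \<subseteq> ?F x"
      by (auto simp: hamming_arcs_def)
    ultimately show "card (?P x y) \<le> card (?F x)"
      using assms by (intro card_inj_on_le) auto
    have "u = v(i := x)" if "(u, v) \<in> ?P x y" for u v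
      using that by (auto simp: hamming_arcs_def fun_eq_iff)
    then have "inj_on snd (?P x y)"
      by (intro inj_on_inverseI[where g = "\<lambda>v. (v(i := x), v)"]) auto
    moreover have "snd ` ?P x y \<subseteq> ?F y"
      by (auto simp: hamming_arcs_def)
    ultimately show "card (?P x y) \<le> card (?F y)"
      using assms by (intro card_inj_on_le) auto
  qed
  have "hamming_arcs {i} S = (\<Union>x\<in>?X. \<Union>y\<in>?X - {x}. ?P x y)"
    by (auto simp: hamming_arcs_def)
  then have "card (hamming_arcs {i} S) = card (\<Union>x\<in>?X. \<Union>y\<in>?X - {x}. ?P x y)"
    by presburger
  also have "\<dots> \<le> (\<Sum>x\<in>?X. card (\<Union>y\<in>?X - {x}. ?P x y))"
    using assms by (intro card_UN_le) auto
  also have "\<dots> \<le> (\<Sum>x\<in>?X. \<Sum>y\<in>?X - {x}. card (?P x y))"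
    using assms by (intro sum_mono card_UN_le) auto
  also have "\<dots> \<le> (\<Sum>x\<in>?X. \<Sum>y\<in>?X - {x}. min (card (?F x)) (card (?F y)))"
    by (intro sum_mono P)
  finally have "real (card (hamming_arcs {i} S))
      \<le> real (\<Sum>x\<in>?X. \<Sum>y\<in>?X - {x}. min (card (?F x)) (card (?F y)))"
    by (rule of_nat_mono)
  then show ?thesis
    by (simp add: of_nat_min)
qed

text \<open>\<open>S\<close> stays arbitrary because the induction hypothesis is applied to its
  fibres over the new coordinate, whose projections are no larger than those of
  \<open>S\<close>.\<close>

lemma card_hamming_arcs_le:
  assumes "finite I" "finite S" "1 \<le> c" "\<And>j. j \<in> I \<Longrightarrow> card ((\<lambda>u. u j) ` S) \<le> c"
  shows "real (card (hamming_arcs I S)) \<le> (real c - 1) * (real (card S) * log 2 (real (card S)))"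
  using assms
proof (induction I arbitrary: S rule: finite_induct)
  case empty
  \<comment> \<open>For empty \<open>S\<close> the factor \<open>card S\<close> vanishes, whatever
    the value of \<open>log 2 0\<close>.\<close>
  have "0 \<le> real (card S) * log 2 (real (card S))"
    by (cases "card S") (simp_all add: zero_le_mult_iff)
  with empty show ?case
    by (simp add: hamming_arcs_def)
next
  case (insert i I S)
  let ?X = "(\<lambda>u. u i) ` S"
  let ?F = "\<lambda>x. {u\<in>S. u i = x}"
  let ?s = "\<lambda>x. real (card (?F x))"
  have fin: "finite S"
    by fact
  have S: "card S = (\<Sum>x\<in>?X. card (?F x))"
  proof -
    have "S = (\<Union>x\<in>?X. ?F x)"
      by auto
    then have "card S = card (\<Union>x\<in>?X. ?F x)"
      by presburger
    also have "\<dots> = (\<Sum>x\<in>?X. card (?F x))"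
      using fin by (intro card_UN_disjoint) auto
    finally show ?thesis .
  qed
  \<comment> \<open>An arc in a direction other than \<open>i\<close> preserves coordinate
    \<open>i\<close>, so both endpoints lie in one fibre.\<close>
  have "hamming_arcs (insert i I) S = hamming_arcs {i} S \<union> (\<Union>x\<in>?X. hamming_arcs I (?F x))"
  proof (rule set_eqI, safe)
    fix u v assume a: "(u, v) \<in> hamming_arcs (insert i I) S"
      and n: "(u, v) \<notin> (\<Union>x\<in>?X. hamming_arcs I (?F x))"
    obtain j where j: "j \<in> insert i I" "u j \<noteq> v j" "\<forall>m. m \<noteq> j \<longrightarrow> u m = v m" and uv: "u \<in> S" "v \<in> S"
      using a by (auto simp: hamming_arcs_def)
    have "j = i"
    proof (rule ccontr)
      assume "j \<noteq> i"
      with j have "j \<in> I" "u i = v i"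
        by auto
      with j uv have "(u, v) \<in> hamming_arcs I (?F (u i))"
        by (auto simp: hamming_arcs_def)
      with n uv show False
        by blast
    qed
    with j uv show "(u, v) \<in> hamming_arcs {i} S"
      by (auto simp: hamming_arcs_def)
  qed (auto simp: hamming_arcs_def)
  then have "card (hamming_arcs (insert i I) S)
      \<le> card (hamming_arcs {i} S) + card (\<Union>x\<in>?X. hamming_arcs I (?F x))"
    by (simp add: card_Un_le)
  also have "\<dots> \<le> card (hamming_arcs {i} S) + (\<Sum>x\<in>?X. card (hamming_arcs I (?F x)))"
    using fin by (intro add_left_mono card_UN_le) auto
  finally have "real (card (hamming_arcs (insert i I) S))
      \<le> real (card (hamming_arcs {i} S) + (\<Sum>x\<in>?X. card (hamming_arcs I (?F x))))"
    by (rule of_nat_mono)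
  also have "\<dots> = real (card (hamming_arcs {i} S)) + (\<Sum>x\<in>?X. real (card (hamming_arcs I (?F x))))"
    by simp
  also have "(\<Sum>x\<in>?X. real (card (hamming_arcs I (?F x))))
      \<le> (\<Sum>x\<in>?X. (real c - 1) * (?s x * log 2 (?s x)))"
  proof (intro sum_mono insert.IH)
    fix x j assume "j \<in> I"
    then have "card ((\<lambda>u. u j) ` S) \<le> c"
      using insert.prems by simp
    moreover have "card ((\<lambda>u. u j) ` ?F x) \<le> card ((\<lambda>u. u j) ` S)"
      using fin by (intro card_mono) auto
    ultimately show "card ((\<lambda>u. u j) ` ?F x) \<le> c"
      by linarith
  qed (use fin insert.prems in auto)
  also have "\<dots> = (real c - 1) * (\<Sum>x\<in>?X. ?s x * log 2 (?s x))"
    by (simp add: sum_distrib_left)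
  also have "real (card (hamming_arcs {i} S)) + \<dots>
      \<le> (\<Sum>x\<in>?X. \<Sum>y\<in>?X - {x}. min (?s x) (?s y)) + (real c - 1) * (\<Sum>x\<in>?X. ?s x * log 2 (?s x))"
    by (intro add_right_mono card_hamming_arcs_direction_le fin)
  also have "\<dots> \<le> (real c - 1) * ((\<Sum>x\<in>?X. ?s x) * log 2 (\<Sum>x\<in>?X. ?s x))"
    using fin insert.prems by (intro sum_min_le_mult_log2) auto
  finally show ?case
    by (simp add: S)
qed

section \<open>Degrees in the Cartesian product\<close>

lemma regular_card_neighbours:
  assumes "pair_graph G" "regular G r" "v \<in> pverts G"
  shows "card {w. (v, w) \<in> parcs G} = r"
proof -
  have "out_arcs (with_proj G) v = Pair v ` {w. (v, w) \<in> parcs G}"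
    by (auto simp: out_arcs_def)
  then have "out_degree (with_proj G) v = card {w. (v, w) \<in> parcs G}"
    by (simp add: out_degree_def card_image inj_on_def)
  with assms(2,3) show ?thesis
    by (simp add: regular_def)
qed

lemma
  assumes "pair_graph G"
  shows pair_graph_finite_verts: "finite (pverts G)"
    and pair_graph_arcs_subset: "(a, b) \<in> parcs G \<Longrightarrow> a \<in> pverts G \<and> b \<in> pverts G \<and> a \<noteq> b"
proof -
  interpret pair_graph G by fact
  show "finite (pverts G)"
    by simp
  show "a \<in> pverts G \<and> b \<in> pverts G \<and> a \<noteq> b" if "(a, b) \<in> parcs G"
    using that in_arcsD1 in_arcsD2 no_loops' by blast
qed

text \<open>Tuples of the product are \<open>undefined\<close> outside \<open>I\<close>, so
  agreement on \<open>I - {j}\<close> extends to all indices other than \<open>j\<close>, as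
  \<open>hamming_arcs\<close> demands.\<close>

lemma cartesian_product_arcE:
  assumes "(u, v) \<in> parcs (cartesian_product I G)"
  obtains j where "j \<in> I" "(u j, v j) \<in> parcs (G j)" "\<And>m. m \<noteq> j \<Longrightarrow> u m = v m"
proof -
  obtain j where j: "j \<in> I" "(u j, v j) \<in> parcs (G j)" "\<forall>m\<in>I - {j}. u m = v m"
    and uv: "u \<in> (\<Pi>\<^sub>E j\<in>I. pverts (G j))" "v \<in> (\<Pi>\<^sub>E j\<in>I. pverts (G j))"
    using assms by (auto simp: cartesian_product_def)
  have "u m = v m" if "m \<noteq> j" for m
    using j(3) that PiE_arb[OF uv(1)] PiE_arb[OF uv(2)] by (cases "m \<in> I") auto
  with j that show ?thesis
    by blast
qed

text \<open>The neighbours of \<open>u\<close> arise by replacing one coordinate with a neighbour in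
  its factor; different directions give different tuples.\<close>

lemma card_neighbours_cartesian_product:
  assumes "finite I" "\<And>j. j \<in> I \<Longrightarrow> pair_graph (G j)" "\<And>j. j \<in> I \<Longrightarrow> regular (G j) (d j)"
    and u: "u \<in> pverts (cartesian_product I G)"
  shows "card {v. (u, v) \<in> parcs (cartesian_product I G)} = (\<Sum>j\<in>I. d j)"
proof -
  let ?N = "\<lambda>j. {y. (u j, y) \<in> parcs (G j)}"
  have uP: "u \<in> (\<Pi>\<^sub>E j\<in>I. pverts (G j))"
    using u by (simp add: cartesian_product_def)
  have arc: "y \<in> pverts (G j) \<and> x \<noteq> y" if "j \<in> I" "(x, y) \<in> parcs (G j)" for j x y
    using pair_graph_arcs_subset[OF assms(2)] that by blast
  have finN: "finite (?N j)" if "j \<in> I" for j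
    using arc that pair_graph_finite_verts[OF assms(2)]
    by (intro finite_subset[of "?N j" "pverts (G j)"]) auto
  have "{v. (u, v) \<in> parcs (cartesian_product I G)} = (\<Union>j\<in>I. (\<lambda>y. u(j := y)) ` ?N j)"
  proof (intro equalityI subsetI)
    fix v assume "v \<in> {v. (u, v) \<in> parcs (cartesian_product I G)}"
    then obtain j where j: "j \<in> I" "(u j, v j) \<in> parcs (G j)" "\<And>m. m \<noteq> j \<Longrightarrow> u m = v m"
      by (auto elim: cartesian_product_arcE)
    then have "v = u(j := v j)"
      by auto
    with j show "v \<in> (\<Union>j\<in>I. (\<lambda>y. u(j := y)) ` ?N j)"
      by blast
  next
    fix v assume "v \<in> (\<Union>j\<in>I. (\<lambda>y. u(j := y)) ` ?N j)"
    then obtain j y where j: "j \<in> I" "(u j, y) \<in> parcs (G j)" "v = u(j := y)"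
      by auto
    with arc[of j] uP have "v \<in> (\<Pi>\<^sub>E j\<in>I. pverts (G j))"
      by (auto simp: PiE_iff extensional_def)
    with j uP show "v \<in> {v. (u, v) \<in> parcs (cartesian_product I G)}"
      by (auto simp: cartesian_product_def intro!: bexI[of _ j])
  qed
  moreover have "card (\<Union>j\<in>I. (\<lambda>y. u(j := y)) ` ?N j) = (\<Sum>j\<in>I. card ((\<lambda>y. u(j := y)) ` ?N j))"
  proof (rule card_UN_disjoint)
    show "\<forall>i\<in>I. \<forall>j\<in>I. i \<noteq> j \<longrightarrow> (\<lambda>y. u(i := y)) ` ?N i \<inter> (\<lambda>y. u(j := y)) ` ?N j = {}"
    proof (intro ballI impI)
      fix i j assume ij: "i \<in> I" "j \<in> I" "i \<noteq> j"
      \<comment> \<open>At index \<open>i\<close> the right side keeps \<open>u i\<close>, while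
        \<open>y\<close> differs from \<open>u i\<close> because factors are loopless.\<close>
      have "u(i := y) \<noteq> u(j := z)" if "(u i, y) \<in> parcs (G i)" for y z
        using arc[OF ij(1) that] ij(3) by (metis fun_upd_other fun_upd_same)
      then show "(\<lambda>y. u(i := y)) ` ?N i \<inter> (\<lambda>y. u(j := y)) ` ?N j = {}"
        by blast
    qed
  qed (use assms(1) finN in auto)
  moreover have "card ((\<lambda>y. u(j := y)) ` ?N j) = d j" if "j \<in> I" for j
  proof -
    have "inj_on (\<lambda>y. u(j := y)) (?N j)"
      by (metis fun_upd_same inj_onI)
    moreover have "u j \<in> pverts (G j)"
      using uP that by auto
    ultimately show ?thesis
      using regular_card_neighbours[OF assms(2,3)] that by (simp add: card_image)
  qed
  ultimately show ?thesis
    by simp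
qed

section \<open>Boundary edges and the isoperimetric bound\<close>

text \<open>Forgetting the orientation is injective on arcs leaving \<open>S\<close>: the tail is
  the endpoint in \<open>S\<close>.\<close>

lemma card_out_boundary_arcs_le:
  assumes "pair_graph G" "S \<subseteq> pverts G"
  shows "card {(u, v) \<in> parcs G. u \<in> S \<and> v \<notin> S} \<le> card (edge_boundary G S)"
proof (rule card_inj_on_le)
  interpret pair_graph G by fact
  show "inj_on (\<lambda>(u, v). {u, v}) {(u, v) \<in> parcs G. u \<in> S \<and> v \<notin> S}"
    by (auto simp: inj_on_def doubleton_eq_iff)
  show "(\<lambda>(u, v). {u, v}) ` {(u, v) \<in> parcs G. u \<in> S \<and> v \<notin> S} \<subseteq> edge_boundary G S"
    using pair_graph_arcs_subset[OF assms(1)] by (fastforce simp: edge_boundary_def edges_def)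
  have "edges G = (\<lambda>(u, v). {u, v}) ` parcs G"
    by (auto simp: edges_def)
  then have "finite (edges G)"
    by simp
  then show "finite (edge_boundary G S)"
    by (simp add: edge_boundary_def)
qed

theorem theorem1:
  fixes C t n k :: nat
    and G :: "nat \<Rightarrow> 'a pair_pre_digraph"
    and d :: "nat \<Rightarrow> nat"
  assumes "C > 1"
    and "\<And>j. j \<in> {1..t} \<Longrightarrow> pair_graph (G j)"
    and "\<And>j. j \<in> {1..t} \<Longrightarrow> regular (G j) (d j)"
    and "\<And>j. j \<in> {1..t} \<Longrightarrow> 1 < card (pverts (G j)) \<and> card (pverts (G j)) \<le> C"
    and "n = card (pverts (cartesian_product {1..t} G))"
    and "k \<in> {1..n}"
  shows "isoperimetric_number k (cartesian_product {1..t} G)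
           \<ge> real (\<Sum>j=1..t. d j) - (real C - 1) * log 2 (real k)"
proof -
  let ?I = "{1..t}"
  let ?P = "cartesian_product ?I G"
  let ?d = "\<Sum>j=1..t. d j"
  have P: "pair_graph ?P"
    using assms(2) by (intro pair_graph_cartesian_product) auto
  have finV: "finite (pverts ?P)"
    by (rule pair_graph_finite_verts[OF P])
  obtain S where S: "S \<subseteq> pverts ?P" "card S = k"
    and iso: "isoperimetric_number k ?P = real (card (edge_boundary ?P S)) / real k"
    using isoperimetric_number_attained[OF finV] assms(5,6) by (metis atLeastAtMost_iff)
  have finS: "finite S"
    using S(1) finV by (rule finite_subset)
  have SP: "S \<subseteq> (\<Pi>\<^sub>E j\<in>?I. pverts (G j))"
    using S(1) by (simp add: cartesian_product_def)
  let ?B = "{(u, v) \<in> parcs ?P. u \<in> S \<and> v \<notin> S}"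
  let ?N = "\<lambda>u. {v. (u, v) \<in> parcs ?P}"
  have finN: "finite (?N u)" for u
    using pair_graph_arcs_subset[OF P] by (intro finite_subset[OF _ finV]) auto
  \<comment> \<open>\<open>Sigma S ?N\<close> consists of the arcs with tail in \<open>S\<close>.
    Those with head in \<open>S\<close> change one coordinate, properly since factors are loopless;
    this is the passage to complete factors.\<close>
  have "Sigma S ?N \<subseteq> ?B \<union> hamming_arcs ?I S"
  proof (rule subrelI, rule ccontr)
    fix u v assume "(u, v) \<in> Sigma S ?N" and n: "(u, v) \<notin> ?B \<union> hamming_arcs ?I S"
    then have u: "u \<in> S" and uv: "(u, v) \<in> parcs ?P"
      by auto
    with n have v: "v \<in> S"
      by auto
    obtain j where j: "j \<in> ?I" "(u j, v j) \<in> parcs (G j)" "\<And>m. m \<noteq> j \<Longrightarrow> u m = v m"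
      using uv by (auto elim: cartesian_product_arcE)
    have "u j \<noteq> v j"
      using pair_graph_arcs_subset[OF assms(2)] j by blast
    then have "(u, v) \<in> hamming_arcs ?I S"
      using u v j by (auto simp: hamming_arcs_def)
    with n show False
      by blast
  qed
  moreover have "finite ?B"
    using pair_graph_arcs_subset[OF P]
    by (intro finite_subset[of ?B "pverts ?P \<times> pverts ?P"]) (use finV in auto)
  ultimately have "card (Sigma S ?N) \<le> card ?B + card (hamming_arcs ?I S)"
    using card_mono[of "?B \<union> hamming_arcs ?I S" "Sigma S ?N"] finite_hamming_arcs[OF finS]
      card_Un_le[of ?B "hamming_arcs ?I S"] by (meson finite_UnI le_trans)
  moreover have "card (Sigma S ?N) = k * ?d"
  proof -
    have "card (?N u) = ?d" if "u \<in> S" for u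
      using assms(2,3) S(1) that by (intro card_neighbours_cartesian_product) auto
    then show ?thesis
      using finS finN S(2) by (simp add: card_SigmaI)
  qed
  ultimately have "k * ?d \<le> card (edge_boundary ?P S) + card (hamming_arcs ?I S)"
    using card_out_boundary_arcs_le[OF P S(1)] by linarith
  then have "real k * real ?d \<le> real (card (edge_boundary ?P S)) + real (card (hamming_arcs ?I S))"
    by (metis of_nat_add of_nat_mono of_nat_mult)
  \<comment> \<open>The bound on factor sizes enters here: coordinate \<open>j\<close> takes values
    in \<open>pverts (G j)\<close>.\<close>
  moreover have "card ((\<lambda>u. u j) ` S) \<le> C" if j: "j \<in> ?I" for j
  proof -
    have "(\<lambda>u. u j) ` S \<subseteq> pverts (G j)"
      using PiE_mem[OF subsetD[OF SP] j] by blast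
    then show ?thesis
      using card_mono[OF pair_graph_finite_verts[OF assms(2)[OF j]]] assms(4)[OF j]
      by (meson le_trans)
  qed
  then have "real (card (hamming_arcs ?I S)) \<le> (real C - 1) * (real k * log 2 (real k))"
    using card_hamming_arcs_le[of ?I S C] finS S(2) assms(1) by simp
  ultimately have "(real ?d - (real C - 1) * log 2 (real k)) * real k
      \<le> real (card (edge_boundary ?P S))"
    by (simp add: algebra_simps)
  moreover have "0 < real k"
    using assms(6) by simp
  ultimately show ?thesis
    unfolding iso by (simp only: pos_le_divide_eq)
qed

end
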